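(* Let $n\ge 2$ and $\alpha>0$, and let $U(\mathbf s)>0$ for $\mathbf s\in S^{n-1}$. Consider the Hamiltonian $$H(r,\mathbf s,p_r,p_{\mathbf s})=\tfrac12\Big(p_r^2+\frac{|p_{\mathbf s}|^2}{r^2}\Big)-r^{-\alpha}U(\mathbf s),\qquad r>0,\ \mathbf s\in S^{n-1},$$ on its phase space with canonical one-form $\theta=p_r\,dr+p_{\mathbf s}\cdot d\mathbf s$ and canonical symplectic form $\omega=d\theta$. Introduce the McGehee variables $(r,v,\mathbf s,\mathbf u)$ by $v=r^{\alpha/2}p_r$, $\mathbf u=r^{\alpha/2-1}p_{\mathbf s}$, and attach the boundary $\{r=0\}$ in these variables. Then the pullback of the canonical symplectic form $\omega$ to McGehee variables is not conformally regularisable at $r=0$ by any admissible conformal factor depending only on $r$. In particular, after the scalar normalisation $r^{\alpha/2}\omega$, the limiting two-form on the boundary is $$\big(r^{\alpha/2}\omega\big)\big|_{r=0}=dr\wedge\Big(-dv+\big(1-\tfrac{\alpha}{2}\big)\,\mathbf u\cdot d\mathbf s\Big),$$ which has rank two and is therefore degenerate on the $2n$-dimensional blown-up phase space.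
   Context: Configuration space: $\mathbf q=r\mathbf s\in\mathbb{R}^n\setminus\{0\}$ with $r>0$, $\mathbf s\in S^{n-1}$; the potential is $V(r,\mathbf s)=-r^{-\alpha}U(\mathbf s)$, homogeneous of degree $-\alpha$. Here $p_r\in\mathbb{R}$, $p_{\mathbf s}\in T^*_{\mathbf s}S^{n-1}$, and $p_{\mathbf s}\cdot d\mathbf s$ denotes the canonical (tautological) one-form on $T^*S^{n-1}$. In McGehee variables $v\in\mathbb{R}$, $\mathbf u\in T^*_{\mathbf s}S^{n-1}$, and $\mathbf u\cdot d\mathbf s$ is again the tautological one-form of $T^*S^{n-1}$ at $(\mathbf s,\mathbf u)$. The blown-up phase space is the $2n$-dimensional manifold with boundary $[0,\infty)\times\mathbb{R}\times T^*S^{n-1}\ni(r,v,(\mathbf s,\mathbf u))$, with boundary $\{r=0\}$ and boundary defining function $r$; the McGehee variables identify its interior $\{r>0\}$ with the original phase space. Admissible conformal factor (depending only on $r$): for some fixed $r_0>0$, a function $f:(0,r_0)\to\mathbb{R}\setminus\{0\}$ of the form $f(r)=r^{-\tilde c}g(r)$, where $\tilde c\in\mathbb{R}$ and $g$ is smooth and nonvanishing on $[0,r_0)$. Conformally regularisable at $r=0$: there exists an admissible conformal factor $f$ such that $f(r)\,\omega$, $r>0$, extends smoothly to $r=0$ as a two-form on the blown-up phase space (near the boundary) that is non-degenerate, as a bilinear form on the full $2n$-dimensional tangent space, at every point of the boundary $\{r=0\}$. The notation $(\cdot)|_{r=0}$ means evaluating the smoothly extended two-form at points of $\{r=0\}$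 as a two-form on the full tangent space (the $dr$ direction is retained); it is not the pullback to the boundary hypersurface. *)

theory Defs
  imports "HOL-Analysis.Analysis"
begin

text \<open>
  All manifolds below are subsets of Euclidean spaces. A differential form is a function taking a
  point and one tangent vector (one-forms) or two tangent vectors (two-forms); only its values on
  the tangent spaces of the manifold are meaningful. Wedge product and exterior derivative are
  normalised so that \<open>dx \<and> dy\<close> takes the value 1 on \<open>(\<partial>\<^sub>x, \<partial>\<^sub>y)\<close>.
\<close>

subsection \<open>Smooth functions and forms\<close>

text \<open>Meant for open \<open>S\<close> only: the derivatives are two-sided.\<close>

primrec Ck_on :: "nat \<Rightarrow> ('a::real_normed_vector \<Rightarrow> 'b::real_normed_vector) \<Rightarrow> 'a set \<Rightarrow> bool" where
  "Ck_on 0 f S \<longleftrightarrow> continuous_on S f"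
| "Ck_on (Suc k) f S \<longleftrightarrow>
     (\<forall>x\<in>S. f differentiable (at x)) \<and> (\<forall>h. Ck_on k (\<lambda>x. frechet_derivative f (at x) h) S)"

definition smooth_on_open :: "'a::real_normed_vector set \<Rightarrow> ('a \<Rightarrow> 'b::real_normed_vector) \<Rightarrow> bool" where
  "smooth_on_open S f \<longleftrightarrow> (\<forall>k. Ck_on k f S)"

text \<open>
  Smoothness on an arbitrary subset (for instance a half-open interval): local existence of smooth
  extensions to open sets of the surrounding space.
\<close>

definition smooth_on_subset :: "'a::real_normed_vector set \<Rightarrow> ('a \<Rightarrow> 'b::real_normed_vector) \<Rightarrow> bool" where
  "smooth_on_subset S f \<longleftrightarrow>
     (\<forall>x\<in>S. \<exists>W F. open W \<and> x \<in> W \<and> smooth_on_open W F \<and> (\<forall>y\<in>W \<inter> S. F y = f y))"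

type_synonym 'e one_form = "'e \<Rightarrow> 'e \<Rightarrow> real"
type_synonym 'e two_form = "'e \<Rightarrow> 'e \<Rightarrow> 'e \<Rightarrow> real"

definition alternating_bilinear :: "('e::real_vector \<Rightarrow> 'e \<Rightarrow> real) \<Rightarrow> bool" where
  "alternating_bilinear b \<longleftrightarrow> bilinear b \<and> (\<forall>X. b X X = 0)"

text \<open>
  \<open>\<eta>\<close> is a smooth two-form on the embedded manifold (possibly with boundary) \<open>M\<close> whose tangent
  space at \<open>x\<close> is \<open>T x\<close>: locally it is the restriction of a smooth two-form of the surrounding space.
\<close>

definition smooth_two_form_on ::
    "'e::euclidean_space set \<Rightarrow> ('e \<Rightarrow> 'e set) \<Rightarrow> 'e two_form \<Rightarrow> bool" where
  "smooth_two_form_on M T \<eta> \<longleftrightarrow>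
     (\<forall>x\<in>M. \<exists>W B. open W \<and> x \<in> W \<and>
        (\<forall>y\<in>W. alternating_bilinear (B y)) \<and>
        (\<forall>X Y. smooth_on_open W (\<lambda>y. B y X Y)) \<and>
        (\<forall>y\<in>W \<inter> M. \<forall>X\<in>T y. \<forall>Y\<in>T y. B y X Y = \<eta> y X Y))"

definition wedge :: "('e \<Rightarrow> real) \<Rightarrow> ('e \<Rightarrow> real) \<Rightarrow> 'e \<Rightarrow> 'e \<Rightarrow> real" where
  "wedge a b X Y = a X * b Y - a Y * b X"

text \<open>
  The invariant formula \<open>d\<theta>(X,Y) = X(\<theta>(Y)) - Y(\<theta>(X)) - \<theta>([X,Y])\<close> for constant vector fields.
  For a form on a submanifold given as the restriction of a form of the surrounding space, the
  exterior derivative is the restriction of the exterior derivative.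
\<close>

definition ext_deriv :: "'e::real_normed_vector one_form \<Rightarrow> 'e two_form" where
  "ext_deriv \<theta> x X Y =
     frechet_derivative (\<lambda>y. \<theta> y Y) (at x) X - frechet_derivative (\<lambda>y. \<theta> y X) (at x) Y"

definition pullback :: "('e::real_normed_vector \<Rightarrow> 'd::real_normed_vector) \<Rightarrow> 'd two_form \<Rightarrow> 'e two_form" where
  "pullback \<Psi> \<beta> x X Y =
     \<beta> (\<Psi> x) (frechet_derivative \<Psi> (at x) X) (frechet_derivative \<Psi> (at x) Y)"

definition form_radical :: "'e set \<Rightarrow> ('e \<Rightarrow> 'e \<Rightarrow> real) \<Rightarrow> 'e set" where
  "form_radical T b = {X \<in> T. \<forall>Y\<in>T. b X Y = 0}"

definition nondegenerate_form :: "'e::real_vector set \<Rightarrow> ('e \<Rightarrow> 'e \<Rightarrow> real) \<Rightarrow> bool" where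
  "nondegenerate_form T b \<longleftrightarrow> form_radical T b = {0}"

definition form_rank :: "'e::euclidean_space set \<Rightarrow> ('e \<Rightarrow> 'e \<Rightarrow> real) \<Rightarrow> nat" where
  "form_rank T b = dim T - dim (form_radical T b)"


subsection \<open>The cotangent bundle of the sphere and the two phase spaces\<close>

text \<open>
  Covectors at \<open>s\<close> are identified with vectors orthogonal to \<open>s\<close> through the round metric: \<open>u\<close>
  stands for the covector \<open>\<sigma> \<mapsto> u \<bullet> \<sigma>\<close> on \<open>T\<^sub>sS\<^sup>n\<^sup>-\<^sup>1\<close>, and the dual norm of the covector is \<open>norm u\<close>.
  The tangent space of the bundle is obtained by differentiating its equations
  \<open>s \<bullet> s = 1\<close> and \<open>s \<bullet> u = 0\<close>.
\<close>

definition cotangent_sphere :: "((real^'n) \<times> (real^'n)) set" where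
  "cotangent_sphere = {(s, u). s \<in> sphere 0 1 \<and> s \<bullet> u = 0}"

definition tangent_cotangent_sphere ::
    "(real^'n) \<times> (real^'n) \<Rightarrow> ((real^'n) \<times> (real^'n)) set" where
  "tangent_cotangent_sphere = (\<lambda>(s, u). {(\<sigma>, \<upsilon>). s \<bullet> \<sigma> = 0 \<and> \<sigma> \<bullet> u + s \<bullet> \<upsilon> = 0})"

text \<open>Coordinates \<open>(r, s, p\<^sub>r, p\<^sub>s)\<close>.\<close>

type_synonym 'n phase = "real \<times> (real^'n) \<times> real \<times> (real^'n)"

definition phase_space :: "'n::finite phase set" where
  "phase_space = {(r, s, pr, ps). r > 0 \<and> (s, ps) \<in> cotangent_sphere}"

definition canonical_one_form :: "'n::finite phase one_form" where
  "canonical_one_form = (\<lambda>(r, s, pr, ps) (\<rho>, \<sigma>, \<pi>r, \<pi>s). pr * \<rho> + ps \<bullet> \<sigma>)"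

definition canonical_symplectic_form :: "'n::finite phase two_form" where
  "canonical_symplectic_form = ext_deriv canonical_one_form"

text \<open>Coordinates \<open>(r, v, s, u)\<close>.\<close>

type_synonym 'n mcgehee = "real \<times> real \<times> (real^'n) \<times> (real^'n)"

definition blowup_space :: "'n::finite mcgehee set" where
  "blowup_space = {(r, v, su). r \<ge> 0 \<and> su \<in> cotangent_sphere}"

text \<open>The full tangent space, also at boundary points: the \<open>r\<close>-component is unrestricted.\<close>

definition blowup_tangent :: "'n::finite mcgehee \<Rightarrow> 'n mcgehee set" where
  "blowup_tangent = (\<lambda>(r, v, su). {(\<rho>, \<nu>, \<sigma>\<upsilon>). \<sigma>\<upsilon> \<in> tangent_cotangent_sphere su})"

definition blowup_interior :: "'n::finite mcgehee set" where
  "blowup_interior = {x \<in> blowup_space. fst x > 0}"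

definition blowup_boundary :: "'n::finite mcgehee set" where
  "blowup_boundary = {x \<in> blowup_space. fst x = 0}"

definition blowup_collar :: "real \<Rightarrow> 'n::finite mcgehee set" where
  "blowup_collar r0 = {x \<in> blowup_space. fst x < r0}"

definition form_dr :: "'n::finite mcgehee one_form" where
  "form_dr = (\<lambda>_ (\<rho>, \<nu>, \<sigma>, \<upsilon>). \<rho>)"

definition form_dv :: "'n::finite mcgehee one_form" where
  "form_dv = (\<lambda>_ (\<rho>, \<nu>, \<sigma>, \<upsilon>). \<nu>)"

text \<open>the tautological form \<open>u \<cdot> ds\<close>\<close>

definition form_u_ds :: "'n::finite mcgehee one_form" where
  "form_u_ds = (\<lambda>(r, v, s, u) (\<rho>, \<nu>, \<sigma>, \<upsilon>). u \<bullet> \<sigma>)"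


subsection \<open>McGehee variables\<close>

definition to_mcgehee :: "real \<Rightarrow> 'n::finite phase \<Rightarrow> 'n mcgehee" where
  "to_mcgehee \<alpha> = (\<lambda>(r, s, pr, ps).
     (r, r powr (\<alpha> / 2) * pr, s, (r powr (\<alpha> / 2 - 1)) *\<^sub>R ps))"

definition from_mcgehee :: "real \<Rightarrow> 'n::finite mcgehee \<Rightarrow> 'n phase" where
  "from_mcgehee \<alpha> = (\<lambda>(r, v, s, u).
     (r, s, r powr (- (\<alpha> / 2)) * v, (r powr (1 - \<alpha> / 2)) *\<^sub>R u))"

lemma from_to_mcgehee:
  assumes "x \<in> phase_space"
  shows "from_mcgehee \<alpha> (to_mcgehee \<alpha> x) = x"
  using assms
  by (auto simp: phase_space_def from_mcgehee_def to_mcgehee_def simp flip: powr_add mult.assoc)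

lemma to_from_mcgehee:
  assumes "x \<in> blowup_interior"
  shows "to_mcgehee \<alpha> (from_mcgehee \<alpha> x) = x"
  using assms
  by (auto simp: blowup_interior_def blowup_space_def from_mcgehee_def to_mcgehee_def
      simp flip: powr_add mult.assoc)

lemma bij_betw_to_mcgehee: "bij_betw (to_mcgehee \<alpha>) phase_space blowup_interior"
proof (rule bij_betw_byWitness[where f' = "from_mcgehee \<alpha>"])
  show "to_mcgehee \<alpha> ` phase_space \<subseteq> blowup_interior"
    by (auto simp: phase_space_def blowup_interior_def blowup_space_def to_mcgehee_def
        cotangent_sphere_def)
  show "from_mcgehee \<alpha> ` blowup_interior \<subseteq> phase_space"
    by (auto simp: phase_space_def blowup_interior_def blowup_space_def from_mcgehee_def
        cotangent_sphere_def)
qed (auto simp: from_to_mcgehee to_from_mcgehee)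

definition mcgehee_symplectic_form :: "real \<Rightarrow> 'n::finite mcgehee two_form" where
  "mcgehee_symplectic_form \<alpha> = pullback (from_mcgehee \<alpha>) canonical_symplectic_form"


subsection \<open>Conformal regularisation\<close>

definition admissible_factor :: "real \<Rightarrow> (real \<Rightarrow> real) \<Rightarrow> bool" where
  "admissible_factor r0 f \<longleftrightarrow> r0 > 0 \<and>
     (\<exists>c g. smooth_on_subset {0..<r0} g \<and> (\<forall>r\<in>{0..<r0}. g r \<noteq> 0) \<and>
            (\<forall>r\<in>{0<..<r0}. f r = r powr (- c) * g r))"

text \<open>
  \<open>\<eta>\<close> is a smooth extension of \<open>f(r) \<omega>\<close> from \<open>0 < r < r0\<close> to \<open>0 \<le> r < r0\<close>; the values of \<open>\<omega>\<close> at
  \<open>r = 0\<close> play no role.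
\<close>

definition smooth_extension ::
    "real \<Rightarrow> (real \<Rightarrow> real) \<Rightarrow> 'n::finite mcgehee two_form \<Rightarrow> 'n mcgehee two_form \<Rightarrow> bool" where
  "smooth_extension r0 f \<omega> \<eta> \<longleftrightarrow>
     smooth_two_form_on (blowup_collar r0) blowup_tangent \<eta> \<and>
     (\<forall>x \<in> blowup_collar r0 \<inter> blowup_interior. \<forall>X \<in> blowup_tangent x. \<forall>Y \<in> blowup_tangent x.
        \<eta> x X Y = f (fst x) * \<omega> x X Y)"

definition conformally_regularisable :: "'n::finite mcgehee two_form \<Rightarrow> bool" where
  "conformally_regularisable \<omega> \<longleftrightarrow>
     (\<exists>r0 f \<eta>. admissible_factor r0 f \<and> smooth_extension r0 f \<omega> \<eta> \<and>
        (\<forall>x \<in> blowup_boundary. nondegenerate_form (blowup_tangent x) (\<eta> x)))"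

end

theory Submission
  imports Defs
begin

text \<open>
  Write \<open>a = \<alpha> / 2\<close>. Substituting \<open>p\<^sub>r = r\<^sup>-\<^sup>a v\<close> and \<open>p\<^sub>s = r\<^sup>1\<^sup>-\<^sup>a u\<close> in \<open>dp\<^sub>r \<and> dr + dp\<^sub>s \<and> ds\<close>, the
  term of \<open>dp\<^sub>r\<close> along \<open>dr\<close> is killed by \<open>\<and> dr\<close>, and the term of \<open>dp\<^sub>s\<close> along \<open>dr\<close> has the same power
  of \<open>r\<close> as \<open>dp\<^sub>r \<and> dr\<close>. Hence (\<open>mcgehee_symplectic_form_eq\<close>)
  \<open>\<omega> = r\<^sup>-\<^sup>a (\<lambda> + r du \<and> ds)\<close> with \<open>\<lambda> = dr \<and> (- dv + (1 - a) u \<cdot> ds)\<close>.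
  The non-degenerate part \<open>du \<and> ds\<close> on the cotangent bundle of the sphere is thus one order smaller
  than \<open>\<lambda>\<close>, and a factor depending on \<open>r\<close> alone rescales both parts together.

  Suppose that \<open>f(r) \<omega>\<close> extends continuously to \<open>r = 0\<close>. Since \<open>\<lambda>(\<partial>\<^sub>r, \<partial>\<^sub>v) = - 1\<close> and \<open>du \<and> ds\<close>
  vanishes on this pair, the coefficient \<open>f(r) r\<^sup>-\<^sup>a\<close> has a finite limit \<open>L\<close>; then
  \<open>f(r) r\<^sup>-\<^sup>a r\<close> tends to 0 and the boundary value of the extension is \<open>L \<lambda>\<close>
  (\<open>smooth_extension_boundary_value\<close>). The form \<open>\<lambda>\<close> is a wedge product of two independent covectors,
  so its radical has dimension \<open>2 n - 2 > 0\<close> (\<open>dim_radical_boundary_form\<close>), and \<open>L \<lambda>\<close> is degenerate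
  for every \<open>L\<close>. For \<open>f(r) = r\<^sup>a\<close> the coefficient is identically 1, whence \<open>L = 1\<close>.
\<close>

section \<open>The symplectic form in McGehee variables\<close>

definition boundary_form :: "real \<Rightarrow> 'n::finite mcgehee two_form" where
  "boundary_form \<alpha> x =
     wedge (form_dr x) (\<lambda>Z. - form_dv x Z + (1 - \<alpha> / 2) * form_u_ds x Z)"

definition form_du_ds :: "'n::finite mcgehee two_form" where
  "form_du_ds = (\<lambda>_ (\<rho>, \<nu>, \<sigma>, \<upsilon>) (\<rho>', \<nu>', \<sigma>', \<upsilon>'). \<upsilon> \<bullet> \<sigma>' - \<upsilon>' \<bullet> \<sigma>)"

definition rescaled_form :: "real \<Rightarrow> 'n::finite mcgehee two_form" where
  "rescaled_form \<alpha> x X Y = boundary_form \<alpha> x X Y + fst x * form_du_ds x X Y"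

lemma rescaled_form_apply:
  "rescaled_form \<alpha> (r, v, s, u) (\<rho>, \<nu>, \<sigma>, \<upsilon>) (\<rho>', \<nu>', \<sigma>', \<upsilon>') =
     \<rho> * (- \<nu>' + (1 - \<alpha> / 2) * (u \<bullet> \<sigma>')) - \<rho>' * (- \<nu> + (1 - \<alpha> / 2) * (u \<bullet> \<sigma>))
     + r * (\<upsilon> \<bullet> \<sigma>' - \<upsilon>' \<bullet> \<sigma>)"
  by (simp add: rescaled_form_def boundary_form_def form_du_ds_def wedge_def form_dr_def
      form_dv_def form_u_ds_def)

lemma canonical_symplectic_form_apply:
  "canonical_symplectic_form x (\<rho>, \<sigma>, \<pi>r, \<pi>s) (\<rho>', \<sigma>', \<pi>r', \<pi>s') =
     \<pi>r * \<rho>' - \<pi>r' * \<rho> + \<pi>s \<bullet> \<sigma>' - \<pi>s' \<bullet> \<sigma>"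
proof -
  have frechet: "frechet_derivative (\<lambda>y. canonical_one_form y (a, b, c, d)) (at x) =
      (\<lambda>h. canonical_one_form h (a, b, c, d))" for a b c d
  proof -
    have "bounded_linear (\<lambda>y. canonical_one_form y (a, b, c, d))"
      unfolding canonical_one_form_def case_prod_unfold
      by (auto intro!: bounded_linear_intros)
    from frechet_derivative_at[OF bounded_linear_imp_has_derivative[OF this], of x]
    show ?thesis by simp
  qed
  show ?thesis
    by (simp add: canonical_symplectic_form_def ext_deriv_def frechet)
      (simp add: canonical_one_form_def)
qed

lemma frechet_derivative_from_mcgehee:
  fixes s u :: "real^'n"
  assumes "r > 0"
  shows "frechet_derivative (from_mcgehee \<alpha>) (at (r, v, s, u)) (\<rho>, \<nu>, \<sigma>, \<upsilon>) =
    (\<rho>, \<sigma>,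
     r powr (- (\<alpha> / 2)) * \<nu> + (- (\<alpha> / 2) * r powr (- (\<alpha> / 2) - 1) * \<rho>) * v,
     r powr (1 - \<alpha> / 2) *\<^sub>R \<upsilon> + ((1 - \<alpha> / 2) * r powr (- (\<alpha> / 2)) * \<rho>) *\<^sub>R u)"
proof -
  let ?x = "(r, v, s, u)"
  have powr: "((\<lambda>y. fst y powr p) has_derivative (\<lambda>h. p * r powr (p - 1) * fst h)) (at ?x)"
    for p
  proof -
    have "((\<lambda>t. t powr p) has_derivative (*) (p * r powr (p - 1))) (at (fst ?x))"
      using has_real_derivative_powr[OF assms, of p] by (simp add: has_field_derivative_def)
    from has_derivative_compose[OF has_derivative_fst[OF has_derivative_ident] this]
    show ?thesis by simp
  qed
  have "((\<lambda>y. (fst y, fst (snd (snd y)), fst y powr (- (\<alpha> / 2)) * fst (snd y),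
        fst y powr (1 - \<alpha> / 2) *\<^sub>R snd (snd (snd y)))) has_derivative
      (\<lambda>h. (fst h, fst (snd (snd h)),
        fst ?x powr (- (\<alpha> / 2)) * fst (snd h)
          + (- (\<alpha> / 2) * r powr (- (\<alpha> / 2) - 1) * fst h) * fst (snd ?x),
        fst ?x powr (1 - \<alpha> / 2) *\<^sub>R snd (snd (snd h))
          + ((1 - \<alpha> / 2) * r powr ((1 - \<alpha> / 2) - 1) * fst h) *\<^sub>R snd (snd (snd ?x))))) (at ?x)"
    by (intro has_derivative_Pair has_derivative_mult has_derivative_scaleR powr
        has_derivative_fst has_derivative_snd has_derivative_ident)
  moreover have "(1 - \<alpha> / 2) - 1 = - (\<alpha> / 2)"
    by simp
  moreover have "(from_mcgehee \<alpha> :: 'n mcgehee \<Rightarrow> _) = (\<lambda>y. (fst y, fst (snd (snd y)),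
      fst y powr (- (\<alpha> / 2)) * fst (snd y), fst y powr (1 - \<alpha> / 2) *\<^sub>R snd (snd (snd y))))"
    by (simp add: from_mcgehee_def case_prod_unfold)
  ultimately have D: "(from_mcgehee \<alpha> has_derivative
      (\<lambda>h. (fst h, fst (snd (snd h)),
        r powr (- (\<alpha> / 2)) * fst (snd h)
          + (- (\<alpha> / 2) * r powr (- (\<alpha> / 2) - 1) * fst h) * v,
        r powr (1 - \<alpha> / 2) *\<^sub>R snd (snd (snd h))
          + ((1 - \<alpha> / 2) * r powr (- (\<alpha> / 2)) * fst h) *\<^sub>R u))) (at ?x)"
    by (simp only: fst_conv snd_conv)
  show ?thesis
    unfolding frechet_derivative_at[OF D, symmetric] by simp
qed

text \<open>
  The derivative of \<open>r\<^sup>-\<^sup>a\<close> contributes only multiples of \<open>dr \<and> dr = 0\<close>, so the singular factor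
  \<open>r\<^sup>-\<^sup>a\<^sup>-\<^sup>1\<close> cancels and everything carries the common factor \<open>r\<^sup>-\<^sup>a\<close>.
\<close>

lemma mcgehee_symplectic_form_eq:
  assumes "fst x > 0"
  shows "mcgehee_symplectic_form \<alpha> x X Y = fst x powr (- (\<alpha> / 2)) * rescaled_form \<alpha> x X Y"
proof -
  obtain r v s u where x: "x = (r, v, s, u)" by (cases x) auto
  obtain \<rho> \<nu> \<sigma> \<upsilon> where X: "X = (\<rho>, \<nu>, \<sigma>, \<upsilon>)" by (cases X) auto
  obtain \<rho>' \<nu>' \<sigma>' \<upsilon>' where Y: "Y = (\<rho>', \<nu>', \<sigma>', \<upsilon>')" by (cases Y) auto
  have r: "r > 0" using assms x by simp
  have power: "r powr (1 - \<alpha> / 2) = r * r powr (- (\<alpha> / 2))"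
    using r powr_add[of r 1 "- (\<alpha> / 2)"] by simp
  show ?thesis
    unfolding x X Y mcgehee_symplectic_form_def pullback_def
      frechet_derivative_from_mcgehee[OF r] canonical_symplectic_form_apply rescaled_form_apply
      power inner_add_left inner_scaleR_left fst_conv
    by algebra
qed

section \<open>Existence of the extension\<close>

text \<open>The derivative of an affine map is constant, and constants are again affine.\<close>

lemma Ck_on_affine:
  assumes "bounded_linear f"
  shows "Ck_on k (\<lambda>x. c + f x) S"
  using assms
proof (induction k arbitrary: c f)
  case 0
  then show ?case
    by (simp add: continuous_on_add linear_continuous_on)
next
  case (Suc k)
  have D: "((\<lambda>x. c + f x) has_derivative f) (at x)" for x
    using has_derivative_add[OF has_derivative_const
        bounded_linear_imp_has_derivative[OF Suc.prems]] by simp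
  have "frechet_derivative (\<lambda>x. c + f x) (at x) = f" for x
    using frechet_derivative_at[OF D] by simp
  moreover have "Ck_on k (\<lambda>x. f h + 0) S" for h
    by (rule Suc.IH) (rule bounded_linear_zero)
  ultimately show ?case
    using D by (auto simp: differentiable_def)
qed

lemma alternating_bilinear_rescaled_form: "alternating_bilinear (rescaled_form \<alpha> x)"
proof -
  have form: "rescaled_form \<alpha> x = (\<lambda>X Y.
      fst X * (- fst (snd Y) + (1 - \<alpha> / 2) * (snd (snd (snd x)) \<bullet> fst (snd (snd Y))))
      - fst Y * (- fst (snd X) + (1 - \<alpha> / 2) * (snd (snd (snd x)) \<bullet> fst (snd (snd X))))
      + fst x * (snd (snd (snd X)) \<bullet> fst (snd (snd Y))
          - snd (snd (snd Y)) \<bullet> fst (snd (snd X))))"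
    by (cases x) (simp add: fun_eq_iff rescaled_form_apply)
  show ?thesis
    unfolding alternating_bilinear_def bilinear_def form
    by (auto intro!: bounded_linear.linear bounded_linear_intros bounded_linear_minus)
qed

text \<open>
  With the tangent vectors held constant, the coefficients of the form are affine in the base
  point \<open>(r, v, s, u)\<close>, so the same formula is a smooth form on the whole surrounding space.
\<close>

lemma smooth_rescaled_form: "smooth_on_open W (\<lambda>x. rescaled_form \<alpha> x X Y)"
proof -
  obtain \<rho> \<nu> \<sigma> \<upsilon> where X: "X = (\<rho>, \<nu>, \<sigma>, \<upsilon>)" by (cases X) auto
  obtain \<rho>' \<nu>' \<sigma>' \<upsilon>' where Y: "Y = (\<rho>', \<nu>', \<sigma>', \<upsilon>')" by (cases Y) auto
  let ?f = "\<lambda>x. (1 - \<alpha> / 2) * (snd (snd (snd x)) \<bullet> (\<rho> *\<^sub>R \<sigma>' - \<rho>' *\<^sub>R \<sigma>))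
    + fst x * (\<upsilon> \<bullet> \<sigma>' - \<upsilon>' \<bullet> \<sigma>)"
  have lin: "bounded_linear ?f"
    by (auto intro!: bounded_linear_intros)
  have form: "(\<lambda>x. rescaled_form \<alpha> x X Y) = (\<lambda>x. (\<rho>' * \<nu> - \<rho> * \<nu>') + ?f x)"
    by (auto simp: X Y rescaled_form_apply inner_diff_right algebra_simps)
  show ?thesis
    unfolding smooth_on_open_def form by (intro allI Ck_on_affine lin)
qed

lemma smooth_extension_rescaled_form:
  "smooth_extension r0 (\<lambda>r. r powr (\<alpha> / 2))
     (mcgehee_symplectic_form \<alpha> :: 'n::finite mcgehee two_form) (rescaled_form \<alpha>)"
  unfolding smooth_extension_def smooth_two_form_on_def
proof (intro conjI ballI)
  fix x :: "'n mcgehee"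
  show "\<exists>W B. open W \<and> x \<in> W \<and> (\<forall>y\<in>W. alternating_bilinear (B y)) \<and>
      (\<forall>X Y. smooth_on_open W (\<lambda>y. B y X Y)) \<and>
      (\<forall>y\<in>W \<inter> blowup_collar r0. \<forall>X\<in>blowup_tangent y. \<forall>Y\<in>blowup_tangent y.
        B y X Y = rescaled_form \<alpha> y X Y)"
    by (rule exI[of _ UNIV], rule exI[of _ "rescaled_form \<alpha>"])
      (simp add: alternating_bilinear_rescaled_form smooth_rescaled_form)
next
  fix x X Y :: "'n mcgehee"
  assume "x \<in> blowup_collar r0 \<inter> blowup_interior"
  then have "fst x > 0" by (simp add: blowup_interior_def)
  then show "rescaled_form \<alpha> x X Y = fst x powr (\<alpha> / 2) * mcgehee_symplectic_form \<alpha> x X Y"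
    by (simp add: mcgehee_symplectic_form_eq flip: powr_add mult.assoc)
qed

section \<open>Boundary values of extensions\<close>

text \<open>
  The tangent space of the blown-up phase space does not depend on \<open>r\<close>, so a pair of vectors
  tangent at the boundary point can be transported unchanged along the ray \<open>t \<mapsto> (t, v, s, u)\<close>,
  where the extension is known for \<open>t > 0\<close>; continuity gives the value at \<open>t = 0\<close>.
\<close>

lemma smooth_extension_tendsto:
  assumes ext: "smooth_extension r0 f (mcgehee_symplectic_form \<alpha>) \<eta>"
    and r0: "r0 > 0"
    and x: "(0, v, s, u) \<in> blowup_boundary"
    and X: "X \<in> blowup_tangent (0, v, s, u)" and Y: "Y \<in> blowup_tangent (0, v, s, u)"
  shows "((\<lambda>t. (f t * t powr (- (\<alpha> / 2))) * rescaled_form \<alpha> (t, v, s, u) X Y)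
    \<longlongrightarrow> \<eta> (0, v, s, u) X Y) (at_right 0)"
proof -
  let ?x = "\<lambda>t. (t, v, s, u)"
  have collar: "?x t \<in> blowup_collar r0" if "0 \<le> t" "t < r0" for t
    using x that by (simp add: blowup_boundary_def blowup_space_def blowup_collar_def)
  have T: "X \<in> blowup_tangent (?x t)" "Y \<in> blowup_tangent (?x t)" for t
    using X Y by (auto simp: blowup_tangent_def)
  obtain W B where W: "open W" "?x 0 \<in> W"
    and smooth: "smooth_on_open W (\<lambda>y. B y X Y)"
    and B: "\<forall>y\<in>W \<inter> blowup_collar r0. \<forall>X\<in>blowup_tangent y. \<forall>Y\<in>blowup_tangent y.
      B y X Y = \<eta> y X Y"
    using ext collar[of 0] r0 unfolding smooth_extension_def smooth_two_form_on_def
    by (metis order_refl)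
  have "Ck_on 0 (\<lambda>y. B y X Y) W"
    using smooth unfolding smooth_on_open_def by blast
  then have "isCont (\<lambda>y. B y X Y) (?x 0)"
    using W by (simp add: continuous_on_eq_continuous_at)
  moreover have ray: "(?x \<longlongrightarrow> ?x 0) (at_right 0)"
    by (intro tendsto_intros)
  ultimately have "((\<lambda>t. B (?x t) X Y) \<longlongrightarrow> B (?x 0) X Y) (at_right 0)"
    by (rule isCont_tendsto_compose)
  moreover have "B (?x 0) X Y = \<eta> (?x 0) X Y"
    using B W(2) collar[of 0] r0 T by auto
  moreover have "eventually (\<lambda>t. B (?x t) X Y =
      (f t * t powr (- (\<alpha> / 2))) * rescaled_form \<alpha> (?x t) X Y) (at_right 0)"
    using topological_tendstoD[OF ray W] eventually_at_right_less[of 0]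
      eventually_at_right_real[OF r0]
  proof eventually_elim
    case (elim t)
    then have "?x t \<in> blowup_collar r0 \<inter> blowup_interior"
      using collar[of t] by (simp add: blowup_interior_def blowup_collar_def)
    then have "\<eta> (?x t) X Y = f t * mcgehee_symplectic_form \<alpha> (?x t) X Y"
      using ext T unfolding smooth_extension_def by fastforce
    then show ?case
      using B elim collar[of t] T by (simp add: mcgehee_symplectic_form_eq)
  qed
  ultimately show ?thesis
    using tendsto_cong[of "\<lambda>t. B (?x t) X Y"] by simp
qed

lemma tendsto_rescaled_form:
  "((\<lambda>t. rescaled_form \<alpha> (t, v, s, u) X Y) \<longlongrightarrow> boundary_form \<alpha> (0, v, s, u) X Y) (at_right 0)"
proof -
  have "rescaled_form \<alpha> (t, v, s, u) X Y =
      boundary_form \<alpha> (0, v, s, u) X Y + t * form_du_ds (0, v, s, u) X Y" for t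
    by (simp add: rescaled_form_def boundary_form_def form_dr_def form_dv_def form_u_ds_def
        form_du_ds_def)
  moreover have "((\<lambda>t. boundary_form \<alpha> (0, v, s, u) X Y + t * form_du_ds (0, v, s, u) X Y)
      \<longlongrightarrow> boundary_form \<alpha> (0, v, s, u) X Y + 0 * form_du_ds (0, v, s, u) X Y) (at_right 0)"
    by (intro tendsto_intros)
  ultimately show ?thesis by simp
qed

text \<open>
  The pair \<open>(\<partial>\<^sub>r, \<partial>\<^sub>v)\<close> reads off the scalar coefficient of the extension up to sign; once that
  coefficient converges, no other pair of tangent vectors can see anything beyond the boundary form.
\<close>

lemma smooth_extension_boundary_value:
  assumes ext: "smooth_extension r0 f (mcgehee_symplectic_form \<alpha>) \<eta>"
    and r0: "r0 > 0"
    and x: "x \<in> blowup_boundary"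
  shows "\<exists>L. ((\<lambda>t. f t * t powr (- (\<alpha> / 2))) \<longlongrightarrow> L) (at_right 0) \<and>
    (\<forall>X\<in>blowup_tangent x. \<forall>Y\<in>blowup_tangent x. \<eta> x X Y = L * boundary_form \<alpha> x X Y)"
proof -
  obtain v s u where xe: "x = (0, v, s, u)"
    using x by (cases x) (auto simp: blowup_boundary_def)
  let ?h = "\<lambda>t. f t * t powr (- (\<alpha> / 2))"
  have "(1, 0, 0, 0) \<in> blowup_tangent (0, v, s, u)" "(0, 1, 0, 0) \<in> blowup_tangent (0, v, s, u)"
    by (auto simp: blowup_tangent_def tangent_cotangent_sphere_def)
  from smooth_extension_tendsto[OF ext r0 x[unfolded xe] this]
  have "((\<lambda>t. - ?h t) \<longlongrightarrow> \<eta> x (1, 0, 0, 0) (0, 1, 0, 0)) (at_right 0)"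
    by (simp add: rescaled_form_apply xe)
  from tendsto_minus[OF this]
  have h: "(?h \<longlongrightarrow> - \<eta> x (1, 0, 0, 0) (0, 1, 0, 0)) (at_right 0)"
    by simp
  show ?thesis
  proof (rule exI, rule conjI[OF h], intro ballI)
    fix X Y assume "X \<in> blowup_tangent x" "Y \<in> blowup_tangent x"
    from smooth_extension_tendsto[OF ext r0 x[unfolded xe] this[unfolded xe]]
      tendsto_mult[OF h tendsto_rescaled_form[of \<alpha> v s u X Y]]
    show "\<eta> x X Y = - \<eta> x (1, 0, 0, 0) (0, 1, 0, 0) * boundary_form \<alpha> x X Y"
      unfolding xe by (rule tendsto_unique[OF trivial_limit_at_right_real])
  qed
qed

section \<open>Rank of the boundary form\<close>

lemma dim_orthogonal_complement:
  fixes A :: "'a::euclidean_space set"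
  shows "dim {y. \<forall>a\<in>A. a \<bullet> y = 0} = DIM('a) - dim A"
proof -
  have "a \<bullet> y = 0" if "a \<in> span A" "\<forall>a\<in>A. a \<bullet> y = 0" for a y
    using orthogonal_to_span[OF that(1), of y] that(2)
    by (simp add: orthogonal_def inner_commute)
  then have "{y. \<forall>a\<in>A. a \<bullet> y = 0} = {y \<in> UNIV. \<forall>a\<in>span A. orthogonal a y}"
    by (auto simp: orthogonal_def span_base)
  then show ?thesis
    using dim_subspace_orthogonal_to_vectors[of "span A" "UNIV :: 'a set"] by simp
qed

text \<open>
  Up to a factor 2, the gradients of the equations \<open>s \<bullet> s = 1\<close> and \<open>s \<bullet> u = 0\<close> that cut out
  the phase space.
\<close>

definition conormals :: "'n::finite mcgehee \<Rightarrow> 'n mcgehee set" where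
  "conormals = (\<lambda>(r, v, s, u). {(0, 0, s, 0), (0, 0, u, s)})"

lemma blowup_tangent_eq: "blowup_tangent x = {y. \<forall>a\<in>conormals x. a \<bullet> y = 0}"
  by (cases x)
    (auto simp: blowup_tangent_def tangent_cotangent_sphere_def conormals_def inner_commute)

lemma dim_conormals:
  assumes "x \<in> blowup_space"
  shows "dim (conormals x) = 2"
proof -
  obtain r v s u where x: "x = (r, v, s, u)" by (cases x) auto
  have "s \<noteq> 0"
    using assms by (auto simp: x blowup_space_def cotangent_sphere_def)
  then show ?thesis
    by (auto simp: x conormals_def dim_insert span_breakdown_eq zero_prod_def)
qed

lemma dim_blowup_tangent:
  fixes x :: "'n::finite mcgehee"
  assumes "x \<in> blowup_space"
  shows "dim (blowup_tangent x) = 2 * CARD('n)"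
  by (simp add: blowup_tangent_eq dim_orthogonal_complement dim_conormals assms)

text \<open>
  Testing against \<open>\<partial>\<^sub>v\<close> and \<open>\<partial>\<^sub>r\<close> shows that both factors of the wedge product vanish on the
  radical, so the radical is the orthogonal complement of the conormals together with the
  gradients of these two factors.
\<close>

lemma radical_boundary_form_eq:
  "form_radical (blowup_tangent (r, v, s, u)) (boundary_form \<alpha> (r, v, s, u)) =
     {y. \<forall>a\<in>insert (1, 0, 0, 0) (insert (0, - 1, (1 - \<alpha> / 2) *\<^sub>R u, 0) (conormals (r, v, s, u))).
        a \<bullet> y = 0}"
    (is "?R = ?K")
proof (rule set_eqI)
  fix X :: "'a mcgehee"
  let ?x = "(r, v, s, u)"
  obtain \<rho> \<nu> \<sigma> \<upsilon> where X: "X = (\<rho>, \<nu>, \<sigma>, \<upsilon>)" by (cases X) auto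
  note form = boundary_form_def wedge_def form_dr_def form_dv_def form_u_ds_def
  have K: "X \<in> ?K \<longleftrightarrow>
      X \<in> blowup_tangent ?x \<and> \<rho> = 0 \<and> - \<nu> + (1 - \<alpha> / 2) * (u \<bullet> \<sigma>) = 0"
    by (auto simp: X blowup_tangent_eq)
  have "(0, 1, 0, 0) \<in> blowup_tangent ?x" "(1, 0, 0, 0) \<in> blowup_tangent ?x"
    by (auto simp: blowup_tangent_def tangent_cotangent_sphere_def)
  then have "boundary_form \<alpha> ?x X (0, 1, 0, 0) = 0" "boundary_form \<alpha> ?x X (1, 0, 0, 0) = 0"
    if "X \<in> ?R"
    using that by (auto simp: form_radical_def)
  then have "\<rho> = 0 \<and> - \<nu> + (1 - \<alpha> / 2) * (u \<bullet> \<sigma>) = 0" if "X \<in> ?R"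
    using that by (simp add: X form)
  moreover have "boundary_form \<alpha> ?x X Y = 0"
    if "\<rho> = 0" "- \<nu> + (1 - \<alpha> / 2) * (u \<bullet> \<sigma>) = 0" for Y
    using that by (auto simp: X form)
  ultimately show "X \<in> ?R \<longleftrightarrow> X \<in> ?K"
    unfolding K by (auto simp: form_radical_def)
qed

lemma dim_radical_boundary_form:
  fixes x :: "'n::finite mcgehee"
  assumes "x \<in> blowup_space"
  shows "dim (form_radical (blowup_tangent x) (boundary_form \<alpha> x)) = 2 * CARD('n) - 2"
proof -
  obtain r v s u where x: "x = (r, v, s, u)" by (cases x) auto
  let ?A = "insert (0, - 1, (1 - \<alpha> / 2) *\<^sub>R u, 0) (conormals x)"
  have "(0, - 1, (1 - \<alpha> / 2) *\<^sub>R u, 0) \<notin> span (conormals x)"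
    by (auto simp: x conormals_def span_breakdown_eq zero_prod_def)
  moreover have "(1, 0, 0, 0) \<notin> span ?A"
    by (auto simp: x conormals_def span_breakdown_eq zero_prod_def)
  ultimately have "dim (insert (1, 0, 0, 0) ?A) = 4"
    using dim_conormals[OF assms] by (simp add: dim_insert)
  then show ?thesis
    unfolding x radical_boundary_form_eq dim_orthogonal_complement by simp
qed

lemma form_radical_cong:
  assumes "\<And>X Y. X \<in> T \<Longrightarrow> Y \<in> T \<Longrightarrow> b X Y = b' X Y"
  shows "form_radical T b = form_radical T b'"
  using assms by (auto simp: form_radical_def)

text \<open>The coefficient may be 0: scaling can only enlarge the radical.\<close>

lemma multiple_of_boundary_form_degenerate:
  fixes x :: "'n::finite mcgehee"
  assumes n: "CARD('n) \<ge> 2" and x: "x \<in> blowup_space"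
    and b: "\<forall>X\<in>blowup_tangent x. \<forall>Y\<in>blowup_tangent x. b X Y = L * boundary_form \<alpha> x X Y"
  shows "\<not> nondegenerate_form (blowup_tangent x) b"
proof
  assume "nondegenerate_form (blowup_tangent x) b"
  then have "form_radical (blowup_tangent x) (boundary_form \<alpha> x) \<subseteq> {0}"
    using b by (force simp: nondegenerate_form_def form_radical_def)
  from dim_subset[OF this] show False
    using n dim_radical_boundary_form[OF x, of \<alpha>] by simp
qed

lemma blowup_boundary_nonempty: "(blowup_boundary :: 'n::finite mcgehee set) \<noteq> {}"
proof -
  have "(0, 0, axis undefined 1, 0) \<in> (blowup_boundary :: 'n mcgehee set)"
    by (simp add: blowup_boundary_def blowup_space_def cotangent_sphere_def)
  then show ?thesis by blast
qed

section \<open>Failure of conformal regularisation\<close>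

theorem proposition4p1:
  fixes \<alpha> :: real
    and U :: "real^'n \<Rightarrow> real"
    and H :: "'n phase \<Rightarrow> real"
  assumes n: "CARD('n) \<ge> 2"
    and \<alpha>: "\<alpha> > 0"
    and U: "\<And>s. s \<in> sphere 0 1 \<Longrightarrow> U s > 0"
    and H: "\<And>r s pr ps. (r, s, pr, ps) \<in> phase_space \<Longrightarrow>
              H (r, s, pr, ps) = (pr\<^sup>2 + (norm ps)\<^sup>2 / r\<^sup>2) / 2 - r powr (- \<alpha>) * U s"
  shows "\<not> conformally_regularisable (mcgehee_symplectic_form \<alpha> :: 'n mcgehee two_form) \<and>
    (\<forall>r0>0.
      (\<exists>\<eta>. smooth_extension r0 (\<lambda>r. r powr (\<alpha> / 2))
             (mcgehee_symplectic_form \<alpha> :: 'n mcgehee two_form) \<eta>) \<and>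
      (\<forall>\<eta>. smooth_extension r0 (\<lambda>r. r powr (\<alpha> / 2))
             (mcgehee_symplectic_form \<alpha> :: 'n mcgehee two_form) \<eta> \<longrightarrow>
        (\<forall>x \<in> blowup_boundary.
          (\<forall>X \<in> blowup_tangent x. \<forall>Y \<in> blowup_tangent x.
             \<eta> x X Y =
               wedge (form_dr x) (\<lambda>Z. - form_dv x Z + (1 - \<alpha> / 2) * form_u_ds x Z) X Y) \<and>
          dim (blowup_tangent x) = 2 * CARD('n) \<and>
          form_rank (blowup_tangent x) (\<eta> x) = 2 \<and>
          \<not> nondegenerate_form (blowup_tangent x) (\<eta> x))))"
proof (intro conjI allI impI ballI)
  show "\<not> conformally_regularisable (mcgehee_symplectic_form \<alpha> :: 'n mcgehee two_form)"
  proof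
    assume "conformally_regularisable (mcgehee_symplectic_form \<alpha> :: 'n mcgehee two_form)"
    then obtain r0 f and \<eta> :: "'n mcgehee two_form"
      where r0: "r0 > 0" and ext: "smooth_extension r0 f (mcgehee_symplectic_form \<alpha>) \<eta>"
        and nondeg: "\<forall>x \<in> blowup_boundary. nondegenerate_form (blowup_tangent x) (\<eta> x)"
      unfolding conformally_regularisable_def admissible_factor_def by blast
    obtain x :: "'n mcgehee" where x: "x \<in> blowup_boundary"
      using blowup_boundary_nonempty by blast
    obtain L where "\<forall>X\<in>blowup_tangent x. \<forall>Y\<in>blowup_tangent x.
        \<eta> x X Y = L * boundary_form \<alpha> x X Y"
      using smooth_extension_boundary_value[OF ext r0 x] by blast
    moreover have "x \<in> blowup_space"
      using x by (simp add: blowup_boundary_def)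
    ultimately have "\<not> nondegenerate_form (blowup_tangent x) (\<eta> x)"
      by (intro multiple_of_boundary_form_degenerate[OF n])
    then show False
      using nondeg x by blast
  qed
next
  fix r0 :: real
  show "\<exists>\<eta>. smooth_extension r0 (\<lambda>r. r powr (\<alpha> / 2))
      (mcgehee_symplectic_form \<alpha> :: 'n mcgehee two_form) \<eta>"
    using smooth_extension_rescaled_form by blast
next
  fix r0 :: real and \<eta> :: "'n mcgehee two_form" and x :: "'n mcgehee"
  assume r0: "r0 > 0"
    and ext: "smooth_extension r0 (\<lambda>r. r powr (\<alpha> / 2)) (mcgehee_symplectic_form \<alpha>) \<eta>"
    and x: "x \<in> blowup_boundary"
  have x': "x \<in> blowup_space"
    using x by (simp add: blowup_boundary_def)
  obtain L where L: "((\<lambda>t. t powr (\<alpha> / 2) * t powr (- (\<alpha> / 2))) \<longlongrightarrow> L) (at_right 0)"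
    and \<eta>L: "\<forall>X\<in>blowup_tangent x. \<forall>Y\<in>blowup_tangent x. \<eta> x X Y = L * boundary_form \<alpha> x X Y"
    using smooth_extension_boundary_value[OF ext r0 x] by blast
  have "eventually (\<lambda>t. t powr (\<alpha> / 2) * t powr (- (\<alpha> / 2)) = 1) (at_right (0::real))"
    using eventually_at_right_less[of 0]
    by eventually_elim (simp flip: powr_add)
  then have "((\<lambda>t. 1) \<longlongrightarrow> L) (at_right (0::real))"
    using L tendsto_cong[of "\<lambda>t. t powr (\<alpha> / 2) * t powr (- (\<alpha> / 2))" "\<lambda>t. 1"] by simp
  then have "L = 1"
    by (simp add: tendsto_const_iff)
  with \<eta>L have \<eta>: "\<eta> x X Y = boundary_form \<alpha> x X Y"
    if "X \<in> blowup_tangent x" "Y \<in> blowup_tangent x" for X Y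
    using that by simp
  show "\<eta> x X Y = wedge (form_dr x) (\<lambda>Z. - form_dv x Z + (1 - \<alpha> / 2) * form_u_ds x Z) X Y"
    if "X \<in> blowup_tangent x" "Y \<in> blowup_tangent x" for X Y
    using \<eta>[OF that] by (simp add: boundary_form_def)
  show "dim (blowup_tangent x) = 2 * CARD('n)"
    by (rule dim_blowup_tangent[OF x'])
  have "form_radical (blowup_tangent x) (\<eta> x) = form_radical (blowup_tangent x) (boundary_form \<alpha> x)"
    using \<eta> by (rule form_radical_cong)
  then show "form_rank (blowup_tangent x) (\<eta> x) = 2"
    using n by (simp add: form_rank_def dim_blowup_tangent x' dim_radical_boundary_form)
  show "\<not> nondegenerate_form (blowup_tangent x) (\<eta> x)"
    using multiple_of_boundary_form_degenerate[OF n x' \<eta>L] .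
qed

end
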